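(* Let $a\in\mathbb{R}^n$ and, for $i=1,\ldots,m$, let $d_i\in\mathbb{R}$, $\tilde{B}_i^{(0)}=(B_i^{(0)},b_i^{(0)})\in\mathbb{R}^{k_i\times n}\times\mathbb{R}^{k_i}=\mathbb{R}^{k_i\times(n+1)}$, $\overline{\Delta}_i\in\mathbb{R}^{k_i\times(n+1)}$, $\rho_i\in\mathbb{R}$, $w_i^1,\ldots,w_i^{l_i}\in\mathbb{R}^{k_i(n+1)}$, $\beta_i^1,\ldots,\beta_i^{l_i}\in\mathbb{R}$, and $$\mathcal{U}_i=\{\tilde{B}_i^{(0)}+\Delta_i:\ \Delta_i\in\mathbb{R}^{k_i\times(n+1)},\ \|\Delta_i-\overline{\Delta}_i\|_F\le\rho_i,\ (w_i^j)^T{\rm vec}(\Delta_i)\le\beta_i^j,\ j=1,\ldots,l_i\}.$$ Consider the robust second-order cone programming problem $$(RSOCP)\quad\min_{x\in\mathbb{R}^n}\ a^Tx\quad\mbox{s.t.}\quad\|B_ix-b_i\|\le d_i\ \ \forall (B_i,b_i)\in\mathcal{U}_i,\ i=1,\ldots,m.$$ Assume that for each $i=1,\ldots,m$, $k_i\ge s_i+1$, where $s_i={\rm dim}\,{\rm span}\{w_i^1,\ldots,w_i^{l_i}\}$, and that $\{\Delta_i:\|\Delta_i-\overline{\Delta}_i\|_F<\rho_i,\ (w_i^j)^T{\rm vec}(\Delta_i)<\beta_i^j,\ j=1,\ldots,l_i\}\ne\emptyset$. Then a point $x\in\mathbb{R}^n$ solves $(RSOCP)$ if and only if, for some $\lambda_i=(\lambda_i^0,\lambda_i^1,\ldots,\lambda_i^{l_i})\in\mathbb{R}_+^{l_i+1}$,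 $i=1,\ldots,m$, the point $(x,\lambda_1,\ldots,\lambda_m)$ solves the linear semidefinite programming problem of minimizing $a^Tx$ over all $x\in\mathbb{R}^n$ and $\lambda_i\in\mathbb{R}^{l_i+1}_+$, $i=1,\ldots,m$, satisfying, for every $i=1,\ldots,m$, $$\left(\begin{array}{ccc} I_{k_i} & I_{k_i}\otimes\tilde{x}^T & B_i^{(0)}x-b_i^{(0)}\\ (I_{k_i}\otimes\tilde{x}^T)^T & \lambda_i^0I_{k_i(n+1)} & -\lambda_i^0\overline{b}_i+\frac12\sum_{j=1}^{l_i}\lambda_i^jw_i^j\\ (B_i^{(0)}x-b_i^{(0)})^T & \big(-\lambda_i^0\overline{b}_i+\frac12\sum_{j=1}^{l_i}\lambda_i^jw_i^j\big)^T & d_i^2-\lambda_i^0(\overline{\gamma}_i-\|\overline{b}_i\|^2)-\sum_{j=1}^{l_i}\lambda_i^j\beta_i^j\end{array}\right)\succeq 0,$$ where $\tilde{x}=(x^T,-1)^T\in\mathbb{R}^{n+1}$, $\overline{b}_i={\rm vec}(\overline{\Delta}_i)$ and $\overline{\gamma}_i=\rho_i^2$.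
   Context: $\|M\|_F=\sqrt{{\rm Tr}(M^TM)}$ is the Frobenius norm, $\|\cdot\|$ the Euclidean norm, and $B\succeq 0$ means $B$ is positive semidefinite. For a $(p\times q)$ matrix $M$, ${\rm vec}(M)\in\mathbb{R}^{pq}$ is the vector obtained by stacking the columns of $M$. $I_p$ is the $p\times p$ identity matrix, and $I_p\otimes\tilde{x}^T\in\mathbb{R}^{p\times p(n+1)}$ is the block-diagonal matrix with $p$ diagonal blocks each equal to the row vector $\tilde{x}^T$. "Solves" means "is a global optimal solution of".
   Formalization: Adds d_i ≥ 0 (the SDP sees only d_i², so the claim fails for d_i < 0), and takes vec to list entries row by row instead of stacking columns, since with I⊗x̃^T column stacking makes the claim false; both changes are needed and no feasible (RSOCP) is lost. *)

theory Defs
  imports Jordan_Normal_Form.DL_Rank Complex_Main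
begin

definition vec_norm :: "real vec \<Rightarrow> real" where
  "vec_norm v = sqrt (v \<bullet> v)"

definition mat_trace :: "real mat \<Rightarrow> real" where
  "mat_trace M = (\<Sum>i<dim_row M. M $$ (i, i))"

definition frob_norm :: "real mat \<Rightarrow> real" where
  "frob_norm M = sqrt (mat_trace (M\<^sup>T * M))"

definition psd :: "real mat \<Rightarrow> bool" where
  "psd M \<longleftrightarrow> square_mat M \<and> M\<^sup>T = M \<and>
     (\<forall>v \<in> carrier_vec (dim_row M). 0 \<le> v \<bullet> (M *\<^sub>v v))"

definition (in vec_space) span_dim :: "'a vec set \<Rightarrow> nat" where
  "span_dim W = vectorspace.dim class_ring (span_vs W)"

text \<open>The columns of a matrix stacked on top of each other.\<close>

definition stack_cols :: "real mat \<Rightarrow> real vec" where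
  "stack_cols M = vec (dim_row M * dim_col M) (\<lambda>r. M $$ (r mod dim_row M, r div dim_row M))"

text \<open>
  The vectorisation of a perturbation lists its entries row by row, i.e. it stacks the columns of
  the transpose.  This is the ordering that fits the block-diagonal matrix \<open>kron_id_row\<close> below: see
  lemma \<open>kron_id_row_mult\<close>.  With the columns of \<open>M\<close> itself stacked,
  the product would not be \<open>M *\<^sub>v y\<close>.
\<close>

definition vectorise :: "real mat \<Rightarrow> real vec" where
  "vectorise M = stack_cols (M\<^sup>T)"

text \<open>The Kronecker product of the identity matrix of size \<open>p\<close> with the row vector \<open>y\<^sup>T\<close>.\<close>

definition kron_id_row :: "nat \<Rightarrow> real vec \<Rightarrow> real mat" where
  "kron_id_row p y = diag_block_mat (replicate p (mat_of_row y))"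

lemma kron_id_row_carrier: "kron_id_row p y \<in> carrier_mat p (p * dim_vec y)"
  by (induction p) (auto simp: kron_id_row_def Let_def mat_of_row_def)

lemma kron_id_row_index:
  assumes "i < p" "c < p * dim_vec y"
  shows "kron_id_row p y $$ (i, c) = (if c div dim_vec y = i then y $ (c mod dim_vec y) else 0)"
  using assms
proof (induction p arbitrary: i c)
  case 0
  then show ?case by simp
next
  case (Suc p)
  let ?q = "dim_vec y"
  have q: "?q > 0" using Suc.prems(2) by (cases ?q) auto
  have dims: "dim_row (kron_id_row p y) = p" "dim_col (kron_id_row p y) = p * ?q"
    using kron_id_row_carrier[of p y] by auto
  have unf: "kron_id_row (Suc p) y =
      four_block_mat (mat_of_row y) (0\<^sub>m 1 (p * ?q)) (0\<^sub>m p ?q) (kron_id_row p y)"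
    using dims by (simp add: kron_id_row_def Let_def)
  show ?case
  proof (cases "c < ?q")
    case True
    then show ?thesis using Suc.prems dims unfolding unf by (auto simp: mat_of_row_def)
  next
    case False
    then have c: "c div ?q = Suc ((c - ?q) div ?q)" "c mod ?q = (c - ?q) mod ?q"
      using q by (auto simp: le_div_geq le_mod_geq)
    have "c - ?q < p * ?q" using Suc.prems(2) False by simp
    then show ?thesis using Suc False dims c unfolding unf
      by (cases i) (auto simp: mat_of_row_def)
  qed
qed

lemma kron_id_row_mult:
  assumes M: "M \<in> carrier_mat p q" and y: "y \<in> carrier_vec q"
  shows "kron_id_row p y *\<^sub>v vectorise M = M *\<^sub>v y"
proof (rule eq_vecI)
  have dims: "dim_row (kron_id_row p y) = p" "dim_col (kron_id_row p y) = p * q"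
    using kron_id_row_carrier[of p y] y by auto
  show "dim_vec (kron_id_row p y *\<^sub>v vectorise M) = dim_vec (M *\<^sub>v y)"
    using dims M by simp
  fix i assume "i < dim_vec (M *\<^sub>v y)"
  then have i: "i < p" using M by simp
  let ?f = "\<lambda>c. (if c div q = i then y $ (c mod q) else 0) * M $$ (c div q, c mod q)"
  have lt: "c div q < p" "c mod q < q" if "c < p * q" for c
    using that by (auto simp: less_mult_imp_div_less) (cases q, auto)
  have "(kron_id_row p y *\<^sub>v vectorise M) $ i =
      (\<Sum>c<p*q. kron_id_row p y $$ (i, c) * vectorise M $ c)"
    using i dims M
    by (simp add: scalar_prod_def vectorise_def stack_cols_def mult.commute atLeast0LessThan)
  also have "\<dots> = (\<Sum>c<p*q. ?f c)"
  proof (rule sum.cong[OF refl])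
    fix c assume "c \<in> {..<p*q}"
    then have c: "c < p * q" by simp
    show "kron_id_row p y $$ (i, c) * vectorise M $ c = ?f c"
      using kron_id_row_index[of i p c y] i c y M lt[OF c]
      by (simp add: vectorise_def stack_cols_def mult.commute[of q])
  qed
  also have "\<dots> = (\<Sum>c\<in>{i*q..<i*q+q}. ?f c)"
  proof (rule sum.mono_neutral_right)
    have "i * q + q \<le> p * q" using i by (metis Suc_leI add.commute mult_Suc mult_le_mono1)
    then show "{i*q..<i*q+q} \<subseteq> {..<p*q}" by auto
    show "\<forall>c\<in>{..<p*q} - {i*q..<i*q+q}. ?f c = 0"
    proof
      fix c assume c: "c \<in> {..<p*q} - {i*q..<i*q+q}"
      then have "c div q \<noteq> i"
        using div_mult_mod_eq[of c q] lt[of c] by (metis Diff_iff add_less_cancel_left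
            atLeastLessThan_iff le_add1 lessThan_iff)
      then show "?f c = 0" by simp
    qed
  qed simp
  also have "\<dots> = (\<Sum>j<q. ?f (i*q + j))"
    by (rule sum.reindex_bij_witness[of _ "\<lambda>j. i*q + j" "\<lambda>c. c - i*q"]) auto
  also have "\<dots> = (\<Sum>j<q. M $$ (i, j) * y $ j)"
    by (rule sum.cong) (auto simp: mult.commute)
  also have "\<dots> = (M *\<^sub>v y) $ i"
    using i M y by (simp add: scalar_prod_def atLeast0LessThan)
  finally show "(kron_id_row p y *\<^sub>v vectorise M) $ i = (M *\<^sub>v y) $ i" .
qed

definition aug_mat :: "real mat \<Rightarrow> real vec \<Rightarrow> real mat" where
  "aug_mat B b = mat_of_cols (dim_row B) (cols B @ [b])"

definition uncertainty_set ::
  "nat \<Rightarrow> nat \<Rightarrow> nat \<Rightarrow> real mat \<Rightarrow> real vec \<Rightarrow> real mat \<Rightarrow> real \<Rightarrow> (nat \<Rightarrow> real vec) \<Rightarrow> (nat \<Rightarrow> real) \<Rightarrow>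
   real mat set" where
  "uncertainty_set n k l B0 b0 \<Delta>c \<rho> w \<beta> =
     {aug_mat B0 b0 + \<Delta> | \<Delta>. \<Delta> \<in> carrier_mat k (n + 1) \<and> frob_norm (\<Delta> - \<Delta>c) \<le> \<rho> \<and>
        (\<forall>j\<in>{1..l}. w j \<bullet> vectorise \<Delta> \<le> \<beta> j)}"

text \<open>The constraint indices \<open>i\<close> and \<open>j\<close> start at 1; coordinates of vectors and matrices start at 0.\<close>

definition rsocp_feasible ::
  "nat \<Rightarrow> nat \<Rightarrow> (nat \<Rightarrow> nat) \<Rightarrow> (nat \<Rightarrow> nat) \<Rightarrow> (nat \<Rightarrow> real mat) \<Rightarrow> (nat \<Rightarrow> real vec) \<Rightarrow>
   (nat \<Rightarrow> real mat) \<Rightarrow> (nat \<Rightarrow> real) \<Rightarrow> (nat \<Rightarrow> nat \<Rightarrow> real vec) \<Rightarrow> (nat \<Rightarrow> nat \<Rightarrow> real) \<Rightarrow>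
   (nat \<Rightarrow> real) \<Rightarrow> real vec \<Rightarrow> bool" where
  "rsocp_feasible n m k l B0 b0 \<Delta>c \<rho> w \<beta> d x \<longleftrightarrow> x \<in> carrier_vec n \<and>
     (\<forall>i\<in>{1..m}. \<forall>B \<in> carrier_mat (k i) n. \<forall>b \<in> carrier_vec (k i).
        aug_mat B b \<in> uncertainty_set n (k i) (l i) (B0 i) (b0 i) (\<Delta>c i) (\<rho> i) (w i) (\<beta> i) \<longrightarrow>
        vec_norm (B *\<^sub>v x - b) \<le> d i)"

text \<open>
  The linear matrix inequality of one constraint; \<open>lam\<close> has the \<open>l + 1\<close> coordinates
  \<open>lam $ 0, \<dots>, lam $ l\<close>, of which \<open>lam $ 0\<close> belongs to the norm ball.
\<close>

definition lmi_mat ::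
  "nat \<Rightarrow> nat \<Rightarrow> nat \<Rightarrow> real mat \<Rightarrow> real vec \<Rightarrow> real mat \<Rightarrow> real \<Rightarrow> (nat \<Rightarrow> real vec) \<Rightarrow> (nat \<Rightarrow> real) \<Rightarrow>
   real \<Rightarrow> real vec \<Rightarrow> real vec \<Rightarrow> real mat" where
  "lmi_mat n k l B0 b0 \<Delta>c \<rho> w \<beta> d x lam =
     (let N = k * (n + 1);
          X = kron_id_row k (x @\<^sub>v vec_of_list [- 1]);
          bc = vectorise \<Delta>c;
          h = vec N (\<lambda>r. - (lam $ 0) * bc $ r + 1/2 * (\<Sum>j=1..l. lam $ j * w j $ r));
          c = mat_of_cols (k + N) [(B0 *\<^sub>v x - b0) @\<^sub>v h];
          \<tau> = d\<^sup>2 - lam $ 0 * (\<rho>\<^sup>2 - (vec_norm bc)\<^sup>2) - (\<Sum>j=1..l. lam $ j * \<beta> j)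
      in four_block_mat
           (four_block_mat (1\<^sub>m k) X (X\<^sup>T) (lam $ 0 \<cdot>\<^sub>m 1\<^sub>m N)) c
           (c\<^sup>T) (mat 1 1 (\<lambda>_. \<tau>)))"

definition sdp_feasible ::
  "nat \<Rightarrow> nat \<Rightarrow> (nat \<Rightarrow> nat) \<Rightarrow> (nat \<Rightarrow> nat) \<Rightarrow> (nat \<Rightarrow> real mat) \<Rightarrow> (nat \<Rightarrow> real vec) \<Rightarrow>
   (nat \<Rightarrow> real mat) \<Rightarrow> (nat \<Rightarrow> real) \<Rightarrow> (nat \<Rightarrow> nat \<Rightarrow> real vec) \<Rightarrow> (nat \<Rightarrow> nat \<Rightarrow> real) \<Rightarrow>
   (nat \<Rightarrow> real) \<Rightarrow> real vec \<times> (nat \<Rightarrow> real vec) \<Rightarrow> bool" where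
  "sdp_feasible n m k l B0 b0 \<Delta>c \<rho> w \<beta> d = (\<lambda>(x, lam). x \<in> carrier_vec n \<and>
     (\<forall>i\<in>{1..m}. lam i \<in> carrier_vec (l i + 1) \<and> (\<forall>j\<le>l i. 0 \<le> lam i $ j) \<and>
        psd (lmi_mat n (k i) (l i) (B0 i) (b0 i) (\<Delta>c i) (\<rho> i) (w i) (\<beta> i) (d i) x (lam i))))"

end

theory Submission
  imports Defs
begin

text \<open>
  Fix \<open>x\<close> and write \<open>r = B0 x - b0\<close>, \<open>u = vec \<Delta>\<close>, \<open>X = I \<otimes> y\<^sup>T\<close> with \<open>y = (x, -1)\<close>, so that the robust constraint
  bounds \<open>\<parallel>r + X u\<parallel>\<^sup>2\<close> on a ball cut by half-spaces.  Since \<open>X X\<^sup>T = \<parallel>y\<parallel>\<^sup>2 I\<close>, adding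
  \<open>\<parallel>y\<parallel>\<^sup>2 (\<parallel>u - c\<parallel>\<^sup>2 - \<rho>\<^sup>2)\<close> to \<open>d\<^sup>2 - \<parallel>r + X u\<parallel>\<^sup>2\<close> gives a convex function \<open>f\<close>, which is affine along
  the range of \<open>X\<^sup>T\<close>.  That range has dimension \<open>k > s\<close>, so it contains a direction orthogonal to all
  \<open>w j\<close>; sliding along it to the sphere without increasing \<open>f\<close> shows that \<open>f\<close> is still nonnegative on the feasible set.
  Convex Lagrange duality for \<open>f\<close> yields the multipliers, and completing the square in the block of the identity
  matrix turns the resulting quadratic inequality into the linear matrix inequality.
\<close>

section \<open>Lagrange duality for convexlike families\<close>

text \<open>The multiplier is the infimum of \<open>f y / - g y\<close> over the points with
  \<open>g y < 0\<close>. For \<open>g x < 0\<close> the claim is that the infimum is a lower bound.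
  For \<open>g x > 0\<close> one shows that \<open>- f x / g x\<close> lies below each quotient, by
  combining \<open>x\<close> with a strictly feasible \<open>y\<close>. Convexity enters only
  through a dominating point \<open>z\<close>, which makes sense without linear structure on the
  type.\<close>

lemma lagrange_multiplier_single:
  fixes f g :: "'a \<Rightarrow> real"
  assumes conv: "\<And>x y t. x \<in> C \<Longrightarrow> y \<in> C \<Longrightarrow> 0 \<le> t \<Longrightarrow> t \<le> 1 \<Longrightarrow>
      \<exists>z\<in>C. f z \<le> (1 - t) * f x + t * f y \<and> g z \<le> (1 - t) * g x + t * g y"
    and slater: "x0 \<in> C" "g x0 < 0"
    and nonneg: "\<And>x. x \<in> C \<Longrightarrow> g x \<le> 0 \<Longrightarrow> 0 \<le> f x"
  obtains \<mu> where "0 \<le> \<mu>" "\<And>x. x \<in> C \<Longrightarrow> 0 \<le> f x + \<mu> * g x"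
proof
  define S where "S = (\<lambda>y. f y / - g y) ` {y \<in> C. g y < 0}"
  have ne: "S \<noteq> {}" using slater unfolding S_def by auto
  have pos: "0 \<le> s" if "s \<in> S" for s
    using that nonneg unfolding S_def by (force intro: divide_nonneg_neg)
  then have bdd: "bdd_below S" by (meson bdd_belowI)
  show "0 \<le> Inf S" using ne pos by (rule cInf_greatest)
  fix x assume x: "x \<in> C"
  consider "g x < 0" | "g x = 0" | "g x > 0" by linarith
  then show "0 \<le> f x + Inf S * g x"
  proof cases
    case 1
    then have "Inf S \<le> f x / - g x" using x bdd unfolding S_def by (intro cInf_lower) auto
    then show ?thesis using 1 by (simp add: field_simps)
  next
    case 2
    then show ?thesis using nonneg x by simp
  next
    case 3
    have "- f x / g x \<le> s" if "s \<in> S" for s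
    proof -
      obtain y where y: "y \<in> C" "g y < 0" and s: "s = f y / - g y"
        using \<open>s \<in> S\<close> unfolding S_def by auto
      \<comment> \<open>This weight makes the combination of \<open>g x\<close> and
        \<open>g y\<close> exactly zero, so the dominating point \<open>z\<close> is feasible and
        \<open>0 \<le> f z\<close>.\<close>
      define t where "t = g x / (g x - g y)"
      have t: "0 \<le> t" "t \<le> 1" "1 - t = - g y / (g x - g y)"
        using 3 y unfolding t_def by (auto simp: field_simps)
      obtain z where z: "z \<in> C" "f z \<le> (1 - t) * f x + t * f y" "g z \<le> (1 - t) * g x + t * g y"
        using conv[OF x y(1) t(1,2)] by blast
      have "(1 - t) * g x + t * g y = 0"
        unfolding t(3) by (simp add: t_def field_simps)
      then have "0 \<le> (1 - t) * f x + t * f y" using nonneg z by fastforce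
      also have "\<dots> = (- g y * f x + g x * f y) / (g x - g y)"
        unfolding t(3) by (simp add: t_def add_divide_distrib diff_divide_distrib)
      finally have "0 \<le> - g y * f x + g x * f y"
        using 3 y by (simp add: zero_le_divide_iff)
      then show ?thesis unfolding s using 3 y by (simp add: field_simps)
    qed
    then have "- f x / g x \<le> Inf S" using ne by (intro cInf_greatest)
    then show ?thesis using 3 by (simp add: field_simps)
  qed
qed

text \<open>The constraints are priced one at a time. The new constraint \<open>i\<close> gets its
  multiplier \<open>\<nu>\<close> over the set \<open>C'\<close> cut out by the remaining ones. Then
  \<open>f + \<nu> * g i\<close> is nonnegative on \<open>C'\<close> and serves as the objective for
  the induction hypothesis, which is why \<open>f\<close> is generalised.\<close>

lemma lagrange_multipliers:
  fixes f :: "'a \<Rightarrow> real" and g :: "'i \<Rightarrow> 'a \<Rightarrow> real"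
  assumes "finite J"
    and "\<And>x y t. x \<in> C \<Longrightarrow> y \<in> C \<Longrightarrow> 0 \<le> t \<Longrightarrow> t \<le> 1 \<Longrightarrow>
      \<exists>z\<in>C. f z \<le> (1 - t) * f x + t * f y \<and> (\<forall>j\<in>J. g j z \<le> (1 - t) * g j x + t * g j y)"
    and "x0 \<in> C" "\<And>j. j \<in> J \<Longrightarrow> g j x0 < 0"
    and "\<And>x. x \<in> C \<Longrightarrow> (\<forall>j\<in>J. g j x \<le> 0) \<Longrightarrow> 0 \<le> f x"
  shows "\<exists>\<mu>. (\<forall>j. 0 \<le> \<mu> j) \<and> (\<forall>x\<in>C. 0 \<le> f x + (\<Sum>j\<in>J. \<mu> j * g j x))"
  using assms
proof (induction J arbitrary: f rule: finite_induct)
  case empty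
  then show ?case by (intro exI[of _ "\<lambda>_. 0"]) auto
next
  case (insert i J)
  define C' where "C' = {x \<in> C. \<forall>j\<in>J. g j x \<le> 0}"
  have C'_conv: "z \<in> C'" if "x \<in> C'" "y \<in> C'" "0 \<le> t" "t \<le> 1" "z \<in> C"
      "\<forall>j\<in>J. g j z \<le> (1 - t) * g j x + t * g j y" for x y z t
  proof -
    have "g j z \<le> 0" if "j \<in> J" for j
    proof -
      have "(1 - t) * g j x \<le> 0" "t * g j y \<le> 0"
        using \<open>j \<in> J\<close> \<open>x \<in> C'\<close> \<open>y \<in> C'\<close> \<open>0 \<le> t\<close> \<open>t \<le> 1\<close>
        by (auto simp: C'_def mult_nonneg_nonpos)
      then show ?thesis using that(1) \<open>\<forall>j\<in>J. g j z \<le> _ j\<close> by fastforce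
    qed
    then show ?thesis using \<open>z \<in> C\<close> by (simp add: C'_def)
  qed
  have "\<exists>z\<in>C'. f z \<le> (1 - t) * f x + t * f y \<and> g i z \<le> (1 - t) * g i x + t * g i y"
    if xy: "x \<in> C'" "y \<in> C'" "0 \<le> t" "t \<le> 1" for x y t
  proof -
    obtain z where z: "z \<in> C" "f z \<le> (1 - t) * f x + t * f y"
        "\<forall>j\<in>insert i J. g j z \<le> (1 - t) * g j x + t * g j y"
      using insert.prems(1)[of x y t] xy unfolding C'_def by blast
    then show ?thesis using C'_conv[OF xy z(1)] by (intro bexI[of _ z]) auto
  qed
  moreover have "x0 \<in> C'" "g i x0 < 0"
    using insert.prems(2,3) unfolding C'_def by (auto intro: less_imp_le)
  moreover have "0 \<le> f x" if "x \<in> C'" "g i x \<le> 0" for x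
    using insert.prems(4)[of x] that unfolding C'_def by auto
  ultimately obtain \<nu> where \<nu>: "0 \<le> \<nu>" "\<And>x. x \<in> C' \<Longrightarrow> 0 \<le> f x + \<nu> * g i x"
    using lagrange_multiplier_single[of C' f "g i" x0] by blast
  have "\<exists>\<mu>. (\<forall>j. 0 \<le> \<mu> j) \<and> (\<forall>x\<in>C. 0 \<le> (f x + \<nu> * g i x) + (\<Sum>j\<in>J. \<mu> j * g j x))"
  proof (rule insert.IH)
    fix x y t assume xy: "x \<in> C" "y \<in> C" "0 \<le> t" "t \<le> (1::real)"
    then obtain z where z: "z \<in> C" "f z \<le> (1 - t) * f x + t * f y"
        "\<forall>j\<in>insert i J. g j z \<le> (1 - t) * g j x + t * g j y"
      using insert.prems(1)[of x y t] by blast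
    \<comment> \<open>The sign of \<open>\<nu>\<close> keeps the new objective convexlike, with the
      same dominating point.\<close>
    have "\<nu> * g i z \<le> \<nu> * ((1 - t) * g i x + t * g i y)"
      using z \<nu>(1) by (intro mult_left_mono) auto
    then show "\<exists>z\<in>C. f z + \<nu> * g i z \<le> (1 - t) * (f x + \<nu> * g i x) + t * (f y + \<nu> * g i y) \<and>
        (\<forall>j\<in>J. g j z \<le> (1 - t) * g j x + t * g j y)"
      using z by (intro bexI[of _ z]) (auto simp: algebra_simps)
  qed (use insert.prems \<nu> in \<open>auto simp: C'_def\<close>)
  then obtain \<mu> where \<mu>: "\<forall>j. 0 \<le> \<mu> j"
      "\<forall>x\<in>C. 0 \<le> (f x + \<nu> * g i x) + (\<Sum>j\<in>J. \<mu> j * g j x)" by blast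
  have "(\<Sum>j\<in>J. (\<mu>(i := \<nu>)) j * g j x) = (\<Sum>j\<in>J. \<mu> j * g j x)" for x
    using insert.hyps by (intro sum.cong) auto
  then show ?case using \<mu> \<nu>(1) insert.hyps
    by (intro exI[of _ "\<mu>(i := \<nu>)"]) (simp add: add.assoc)
qed

section \<open>Linear algebra\<close>

text \<open>A dimension count: a maximal independent \<open>U \<subseteq> W\<close> has
  \<open>span_dim W < k\<close> elements and spans \<open>W\<close>. Orthogonality of
  \<open>X\<^sup>T z\<close> to \<open>U\<close> amounts to the equations
  \<open>(X u) \<bullet> z = 0\<close>, fewer than \<open>k\<close> in \<open>k\<close> unknowns, so
  a nonzero solution exists.\<close>

lemma (in vec_space) exists_transpose_mult_orthogonal:
  assumes W: "W \<subseteq> carrier_vec n" "finite W" and X: "X \<in> carrier_mat k n"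
    and dim: "span_dim W < k"
  obtains z where "z \<in> carrier_vec k" "z \<noteq> 0\<^sub>v k" "\<And>w. w \<in> W \<Longrightarrow> w \<bullet> (X\<^sup>T *\<^sub>v z) = 0"
proof -
  obtain U where U: "finite U" "maximal U (\<lambda>T. T \<subseteq> W \<and> lin_indpt T)"
    using maximal_exists_superset[of W "\<lambda>T. T \<subseteq> W \<and> lin_indpt T" "{}"] W
    by (auto simp: lin_dep_def)
  then have UW: "U \<subseteq> W" by (simp add: maximal_def)
  have card: "card U < k" using dim dim_span[OF _ W(2) U(2)] W(1) by (simp add: span_dim_def)
  have span: "W \<subseteq> span U"
  proof
    fix w assume w: "w \<in> W"
    show "w \<in> span U"
    proof (rule ccontr)
      assume "w \<notin> span U"
      then have notin: "w \<notin> U" using UW W in_own_span[of U] by auto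
      have "lin_indpt (insert w U)"
        using lin_dep_iff_in_span[of U w] \<open>w \<notin> span U\<close> notin U UW W w by (auto simp: maximal_def)
      then show False using U notin w UW unfolding maximal_def by blast
    qed
  qed
  obtain us where us: "set us = U" "length us = card U"
    using finite_distinct_list[OF U(1)] distinct_card by metis
  \<comment> \<open>The system is padded with zero rows to a square matrix, so that a vanishing
    determinant yields \<open>z\<close>. Zeroing row \<open>k - 1\<close> loses no equation because
    \<open>card U < k\<close>; it only gives \<open>A\<close> the form that \<open>det_row_0\<close>
    expects.\<close>
  define c where "c i = (if i < card U then X *\<^sub>v (us ! i) else 0\<^sub>v k)" for i
  define A where "A = mat\<^sub>r k k (\<lambda>i. if i = k - 1 then 0\<^sub>v k else c i)"
  have us_c: "us ! i \<in> carrier_vec n" if "i < card U" for i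
    using that us UW W nth_mem[of i us] by auto
  have c: "c i \<in> carrier_vec k" for i using us_c X unfolding c_def by auto
  have A: "A \<in> carrier_mat k k" unfolding A_def by simp
  have "det A = 0" unfolding A_def using card c by (intro det_row_0) auto
  then obtain z where z: "z \<in> carrier_vec k" "z \<noteq> 0\<^sub>v k" "A *\<^sub>v z = 0\<^sub>v k"
    using det_0_iff_vec_prod_zero_field[OF A] by blast
  have Xz: "X\<^sup>T *\<^sub>v z \<in> carrier_vec n" using X z by simp
  have orth: "u \<bullet> (X\<^sup>T *\<^sub>v z) = 0" if "u \<in> U" for u
  proof -
    have "u \<in> set us" using that us by simp
    then obtain i where i: "i < card U" "u = us ! i" unfolding in_set_conv_nth us(2) by blast
    have u: "u \<in> carrier_vec n" using i us_c by simp
    have "0 = (A *\<^sub>v z) $ i" using z(3) i card by simp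
    also have "\<dots> = (X *\<^sub>v u) \<bullet> z" using i card c[of i] unfolding A_def by (simp add: c_def)
    also have "\<dots> = z \<bullet> (X *\<^sub>v u)" using X u z by (intro comm_scalar_prod) auto
    also have "\<dots> = (X\<^sup>T *\<^sub>v z) \<bullet> u" using transpose_vec_mult_scalar[OF X u z(1)] by simp
    also have "\<dots> = u \<bullet> (X\<^sup>T *\<^sub>v z)" using Xz u by (intro comm_scalar_prod)
    finally show ?thesis by simp
  qed
  have "w \<bullet> (X\<^sup>T *\<^sub>v z) = 0" if "w \<in> W" for w
  proof -
    have "w \<in> span U" using that span by blast
    then obtain b B where w: "w = lincomb b B" and B: "finite B" "B \<subseteq> U"
      using in_spanE by blast
    have Bc: "B \<subseteq> carrier_vec n" using B UW W by auto
    have "w \<bullet> (X\<^sup>T *\<^sub>v z) = (\<Sum>u\<in>B. (b u \<cdot>\<^sub>v u) \<bullet> (X\<^sup>T *\<^sub>v z))"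
      unfolding w lincomb_def module_vec_simps
      by (rule finsum_scalar_prod_sum[OF _ Xz]) (use Bc in auto)
    also have "\<dots> = (\<Sum>u\<in>B. b u * (u \<bullet> (X\<^sup>T *\<^sub>v z)))"
      using Bc Xz by (intro sum.cong) auto
    also have "\<dots> = 0" using orth B by (intro sum.neutral) auto
    finally show ?thesis .
  qed
  with z show thesis using that by blast
qed

section \<open>Squared norms and scaled coisometries\<close>

lemma scalar_prod_self_nonneg: "0 \<le> (v::real vec) \<bullet> v"
  by (simp add: scalar_prod_def sum_nonneg)

lemma scalar_prod_self_pos:
  assumes "(v::real vec) \<in> carrier_vec n" "v \<noteq> 0\<^sub>v n"
  shows "0 < v \<bullet> v"
proof -
  obtain i where "i < n" "v $ i \<noteq> 0" using assms by (metis carrier_vecD eq_vecI index_zero_vec)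
  then show ?thesis using assms
    unfolding scalar_prod_def by (intro sum_pos2[of _ i]) (auto simp: zero_less_mult_iff linorder_neq_iff)
qed

lemma scalar_prod_self_add:
  assumes "(a::real vec) \<in> carrier_vec n" "b \<in> carrier_vec n"
  shows "(a + b) \<bullet> (a + b) = a \<bullet> a + 2 * (a \<bullet> b) + b \<bullet> b"
  using assms comm_scalar_prod[of b n a]
  by (simp add: add_scalar_prod_distrib[of _ n] scalar_prod_add_distrib[of _ n])

lemma scalar_prod_self_diff:
  assumes "(a::real vec) \<in> carrier_vec n" "b \<in> carrier_vec n"
  shows "(a - b) \<bullet> (a - b) = a \<bullet> a - 2 * (a \<bullet> b) + b \<bullet> b"
  using assms comm_scalar_prod[of b n a]
  by (simp add: minus_scalar_prod_distrib[of _ n] scalar_prod_minus_distrib[of _ n])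

text \<open>The exact defect is recorded, not just convexity, because later two squared norms enter
  with opposite signs and their defects have to be compared.\<close>

lemma scalar_prod_self_convex_comb:
  assumes "(a::real vec) \<in> carrier_vec n" "b \<in> carrier_vec n"
  shows "((1 - t) \<cdot>\<^sub>v a + t \<cdot>\<^sub>v b) \<bullet> ((1 - t) \<cdot>\<^sub>v a + t \<cdot>\<^sub>v b) =
    (1 - t) * (a \<bullet> a) + t * (b \<bullet> b) - t * (1 - t) * ((a - b) \<bullet> (a - b))"
  using assms comm_scalar_prod[of b n a]
  by (simp add: scalar_prod_self_diff[of _ n] scalar_prod_self_add[of _ n] algebra_simps)

text \<open>Up to the factor \<open>sqrt \<sigma>\<close> the rows of \<open>X\<close> are
  orthonormal. Expanding the squared norm of \<open>\<sigma> q - X\<^sup>T X q\<close> gives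
  \<open>\<sigma>\<close> times the difference of the two sides.\<close>

lemma scaled_coisometry_contracts:
  fixes X :: "real mat"
  assumes X: "X \<in> carrier_mat k n" and \<sigma>: "0 < \<sigma>"
    and coiso: "\<And>z. z \<in> carrier_vec k \<Longrightarrow> X *\<^sub>v (X\<^sup>T *\<^sub>v z) = \<sigma> \<cdot>\<^sub>v z"
    and q: "q \<in> carrier_vec n"
  shows "(X *\<^sub>v q) \<bullet> (X *\<^sub>v q) \<le> \<sigma> * (q \<bullet> q)"
proof -
  let ?y = "X\<^sup>T *\<^sub>v (X *\<^sub>v q)"
  have c: "X *\<^sub>v q \<in> carrier_vec k" "?y \<in> carrier_vec n" using X q by auto
  have "?y \<bullet> q = (X *\<^sub>v q) \<bullet> (X *\<^sub>v q)" by (rule transpose_vec_mult_scalar[OF X q c(1)])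
  moreover have "?y \<bullet> ?y = \<sigma> * ((X *\<^sub>v q) \<bullet> (X *\<^sub>v q))"
    using transpose_vec_mult_scalar[OF X c(2,1)] coiso[OF c(1)] c by simp
  moreover have "0 \<le> (\<sigma> \<cdot>\<^sub>v q - ?y) \<bullet> (\<sigma> \<cdot>\<^sub>v q - ?y)" by (rule scalar_prod_self_nonneg)
  ultimately have "0 \<le> \<sigma> * (\<sigma> * (q \<bullet> q) - (X *\<^sub>v q) \<bullet> (X *\<^sub>v q))"
    using c q comm_scalar_prod[OF q c(2)]
    by (simp add: scalar_prod_self_diff[of _ n] algebra_simps)
  then show ?thesis using \<sigma> by (simp add: zero_le_mult_iff)
qed

text \<open>The larger root works: \<open>c \<le> 0\<close> makes the reduced discriminant at least
  \<open>b\<^sup>2\<close>, whatever the sign of \<open>b\<close>. It will be the step length from a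
  point of a ball to the sphere along a given direction.\<close>

lemma nonneg_quadratic_root:
  fixes a b c :: real
  assumes "0 < a" "c \<le> 0"
  obtains s where "0 \<le> s" "a * s\<^sup>2 + 2 * b * s + c = 0"
proof
  let ?D = "b\<^sup>2 - a * c"
  have D: "b\<^sup>2 \<le> ?D" using assms by (simp add: mult_nonneg_nonpos)
  then have "\<bar>b\<bar> \<le> sqrt ?D" by (simp add: real_le_rsqrt)
  then show "0 \<le> (- b + sqrt ?D) / a" using assms by simp
  have "(sqrt ?D)\<^sup>2 = ?D" using D by (smt (verit) real_sqrt_pow2 zero_le_power2)
  then show "a * ((- b + sqrt ?D) / a)\<^sup>2 + 2 * b * ((- b + sqrt ?D) / a) + c = 0"
    using assms by (simp add: field_simps power2_eq_square)
qed

section \<open>The S-lemma for a ball cut by half-spaces\<close>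

text \<open>Duality cannot be applied to \<open>D - E\<close>, which is concave; it is applied to
  \<open>f\<close>, which already contains \<open>\<sigma>\<close> copies of the ball constraint.
  Hence the final ball multiplier is at least \<open>\<sigma>\<close>. This bound is part of the
  conclusion because the matrix inequality also tests directions at infinity.\<close>

lemma ball_halfspaces_S_lemma:
  fixes X :: "real mat" and w :: "nat \<Rightarrow> real vec" and \<beta> :: "nat \<Rightarrow> real"
  assumes X: "X \<in> carrier_mat k n" and \<sigma>: "0 < \<sigma>"
    and coiso: "\<And>z. z \<in> carrier_vec k \<Longrightarrow> X *\<^sub>v (X\<^sup>T *\<^sub>v z) = \<sigma> \<cdot>\<^sub>v z"
    and r: "r \<in> carrier_vec k" and c: "c \<in> carrier_vec n"
    and w: "\<And>j. j \<in> {1..l} \<Longrightarrow> w j \<in> carrier_vec n"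
    and z: "z \<in> carrier_vec k" "z \<noteq> 0\<^sub>v k" "\<And>j. j \<in> {1..l} \<Longrightarrow> w j \<bullet> (X\<^sup>T *\<^sub>v z) = 0"
    and slater: "u0 \<in> carrier_vec n" "(u0 - c) \<bullet> (u0 - c) < R"
      "\<And>j. j \<in> {1..l} \<Longrightarrow> w j \<bullet> u0 < \<beta> j"
    and bound: "\<And>u. u \<in> carrier_vec n \<Longrightarrow> (u - c) \<bullet> (u - c) \<le> R \<Longrightarrow>
      (\<forall>j\<in>{1..l}. w j \<bullet> u \<le> \<beta> j) \<Longrightarrow> (r + X *\<^sub>v u) \<bullet> (r + X *\<^sub>v u) \<le> D"
  shows "\<exists>\<mu>. (\<forall>j. 0 \<le> \<mu> j) \<and> \<sigma> \<le> \<mu> 0 \<and> (\<forall>u\<in>carrier_vec n. (r + X *\<^sub>v u) \<bullet> (r + X *\<^sub>v u) \<le>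
    D + \<mu> 0 * ((u - c) \<bullet> (u - c) - R) + (\<Sum>j=1..l. \<mu> j * (w j \<bullet> u - \<beta> j)))"
proof -
  define E where "E u = (r + X *\<^sub>v u) \<bullet> (r + X *\<^sub>v u)" for u
  define B where "B u = (u - c) \<bullet> (u - c)" for u
  define f where "f u = D - E u + \<sigma> * (B u - R)" for u
  \<comment> \<open>Index 0 is the ball and 1 to \<open>l\<close> are the half-spaces, the same
    numbering as the coordinates of the multiplier vector.\<close>
  define g where "g j u = (if j = 0 then B u - R else w j \<bullet> u - \<beta> j)" for j u
  have affine_E: "E ((1 - t) \<cdot>\<^sub>v x + t \<cdot>\<^sub>v y) =
      (1 - t) * E x + t * E y - t * (1 - t) * ((X *\<^sub>v (x - y)) \<bullet> (X *\<^sub>v (x - y)))"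
    if "x \<in> carrier_vec n" "y \<in> carrier_vec n" for x y t
  proof -
    let ?a = "r + X *\<^sub>v x" and ?b = "r + X *\<^sub>v y"
    have "X *\<^sub>v ((1 - t) \<cdot>\<^sub>v x + t \<cdot>\<^sub>v y) = (1 - t) \<cdot>\<^sub>v (X *\<^sub>v x) + t \<cdot>\<^sub>v (X *\<^sub>v y)"
      using that X by (simp add: mult_add_distrib_mat_vec[of _ k n] mult_mat_vec[of _ k n])
    then have "r + X *\<^sub>v ((1 - t) \<cdot>\<^sub>v x + t \<cdot>\<^sub>v y) = (1 - t) \<cdot>\<^sub>v ?a + t \<cdot>\<^sub>v ?b"
      using that X r by (intro eq_vecI) (auto simp: algebra_simps)
    moreover have "?a - ?b = X *\<^sub>v (x - y)"
      unfolding mult_minus_distrib_mat_vec[OF X that] using that X r by (intro eq_vecI) auto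
    ultimately show ?thesis
      unfolding E_def using scalar_prod_self_convex_comb[of ?a k ?b t] that X r by simp
  qed
  have affine_B: "B ((1 - t) \<cdot>\<^sub>v x + t \<cdot>\<^sub>v y) =
      (1 - t) * B x + t * B y - t * (1 - t) * ((x - y) \<bullet> (x - y))"
    if "x \<in> carrier_vec n" "y \<in> carrier_vec n" for x y t
  proof -
    have "(1 - t) \<cdot>\<^sub>v x + t \<cdot>\<^sub>v y - c = (1 - t) \<cdot>\<^sub>v (x - c) + t \<cdot>\<^sub>v (y - c)"
      using that c by (intro eq_vecI) (auto simp: algebra_simps)
    moreover have "(x - c) - (y - c) = x - y"
      using that c by (intro eq_vecI) auto
    ultimately show ?thesis
      unfolding B_def using scalar_prod_self_convex_comb[of "x - c" n "y - c" t] that c by simp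
  qed
  have conv: "\<exists>z\<in>carrier_vec n. f z \<le> (1 - t) * f x + t * f y \<and>
      (\<forall>j\<in>{0..l}. g j z \<le> (1 - t) * g j x + t * g j y)"
    if xy: "x \<in> carrier_vec n" "y \<in> carrier_vec n" "0 \<le> t" "t \<le> 1" for x y t
  proof (rule bexI[of _ "(1 - t) \<cdot>\<^sub>v x + t \<cdot>\<^sub>v y"], intro conjI ballI)
    let ?z = "(1 - t) \<cdot>\<^sub>v x + t \<cdot>\<^sub>v y" and ?h = "x - y"
    have h: "?h \<in> carrier_vec n" using xy by simp
    have tt: "0 \<le> t * (1 - t)" using xy by simp
    \<comment> \<open>The defect from \<open>- E\<close> has the wrong sign, and the one from
      \<open>\<sigma> * B\<close> outweighs it by this inequality.\<close>
    have "(X *\<^sub>v ?h) \<bullet> (X *\<^sub>v ?h) \<le> \<sigma> * (?h \<bullet> ?h)"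
      by (rule scaled_coisometry_contracts[OF X \<sigma> coiso h])
    from mult_left_mono[OF this tt] show "f ?z \<le> (1 - t) * f x + t * f y"
      unfolding f_def affine_E[OF xy(1,2)] affine_B[OF xy(1,2)] by (simp add: algebra_simps)
    fix j assume j: "j \<in> {0..l}"
    show "g j ?z \<le> (1 - t) * g j x + t * g j y"
    proof (cases "j = 0")
      case True
      then show ?thesis
        using mult_nonneg_nonneg[OF tt scalar_prod_self_nonneg[of ?h]]
        unfolding g_def affine_B[OF xy(1,2)] by (simp add: algebra_simps)
    next
      case False
      then have "w j \<in> carrier_vec n" using w j by simp
      then have "w j \<bullet> ?z = (1 - t) * (w j \<bullet> x) + t * (w j \<bullet> y)"
        using xy by (simp add: scalar_prod_add_distrib[of _ n])
      then show ?thesis using False by (simp add: g_def algebra_simps)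
    qed
  qed (use xy in simp)
  have g_iff: "(\<forall>j\<in>{0..l}. g j u \<le> 0) \<longleftrightarrow> B u \<le> R \<and> (\<forall>j\<in>{1..l}. w j \<bullet> u \<le> \<beta> j)" for u
    by (force simp: g_def)
  define v where "v = X\<^sup>T *\<^sub>v z"
  have v: "v \<in> carrier_vec n" unfolding v_def using X z by simp
  have Xv: "X *\<^sub>v v = \<sigma> \<cdot>\<^sub>v z" unfolding v_def using coiso z by simp
  have vv: "v \<bullet> v = \<sigma> * (z \<bullet> z)"
    using transpose_vec_mult_scalar[OF X v z(1)] Xv z(1) unfolding v_def by simp
  have vpos: "0 < v \<bullet> v" unfolding vv using \<sigma> scalar_prod_self_pos[OF z(1,2)] by simp
  \<comment> \<open>The quadratic part of \<open>f\<close> vanishes on \<open>v\<close>, so \<open>f\<close> is affine along \<open>v\<close> and attains its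
    minimum over the feasible chord on the sphere, where it coincides with \<open>D - E\<close>.\<close>
  have nonneg: "0 \<le> f u" if u: "u \<in> carrier_vec n" and feas: "\<forall>j\<in>{0..l}. g j u \<le> 0" for u
  proof -
    \<comment> \<open>Half the slope of \<open>f\<close> along \<open>v\<close>. The sign
      \<open>e\<close> selects the orientation of \<open>v\<close> in which \<open>f\<close> does
      not increase.\<close>
    define s where "s = \<sigma> * ((u - c) \<bullet> v) - (r + X *\<^sub>v u) \<bullet> (X *\<^sub>v v)"
    define e where "e = (if s \<le> 0 then 1 else - 1 :: real)"
    have e: "e * s \<le> 0" "e * e = 1" unfolding e_def by auto
    define p where "p = e * ((u - c) \<bullet> v)"
    have "B u \<le> R" using feas g_iff by blast
    \<comment> \<open>The equation says that \<open>u + t e v\<close> lies on the sphere, since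
      \<open>e * e = 1\<close>.\<close>
    then obtain t where t: "0 \<le> t" "v \<bullet> v * t\<^sup>2 + 2 * p * t + (B u - R) = 0"
      using nonneg_quadratic_root[of "v \<bullet> v" "B u - R" p] vpos by auto
    define \<theta> where "\<theta> = t * e"
    define y where "y = u + \<theta> \<cdot>\<^sub>v v"
    have y: "y \<in> carrier_vec n" unfolding y_def using u v by simp
    have "y - c = (u - c) + \<theta> \<cdot>\<^sub>v v"
      unfolding y_def using u v c by (intro eq_vecI) auto
    then have "B y = B u + 2 * \<theta> * ((u - c) \<bullet> v) + \<theta>\<^sup>2 * (v \<bullet> v)"
      unfolding B_def using u v c by (simp add: scalar_prod_self_add[of _ n] power2_eq_square)
    also have "\<theta>\<^sup>2 = t\<^sup>2" using e(2) by (simp add: \<theta>_def power2_eq_square algebra_simps)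
    finally have By: "B y = B u + 2 * \<theta> * ((u - c) \<bullet> v) + t\<^sup>2 * (v \<bullet> v)" .
    then have ByR: "B y = R" using t(2) by (simp add: p_def \<theta>_def algebra_simps)
    have "X *\<^sub>v y = X *\<^sub>v u + \<theta> \<cdot>\<^sub>v (X *\<^sub>v v)" unfolding y_def using X u v
      by (simp add: mult_add_distrib_mat_vec[of _ k n] mult_mat_vec[of _ k n])
    then have "r + X *\<^sub>v y = (r + X *\<^sub>v u) + \<theta> \<cdot>\<^sub>v (X *\<^sub>v v)"
      using X r u v by (intro eq_vecI) auto
    moreover have "r + X *\<^sub>v u \<in> carrier_vec k" "\<theta> \<cdot>\<^sub>v (X *\<^sub>v v) \<in> carrier_vec k"
      using X r u v by auto
    ultimately have "E y = E u + 2 * \<theta> * ((r + X *\<^sub>v u) \<bullet> (X *\<^sub>v v)) + \<theta>\<^sup>2 * ((X *\<^sub>v v) \<bullet> (X *\<^sub>v v))"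
      unfolding E_def using X v by (simp add: scalar_prod_self_add power2_eq_square)
    also have "(X *\<^sub>v v) \<bullet> (X *\<^sub>v v) = \<sigma> * (v \<bullet> v)" unfolding Xv vv using z(1) by simp
    also have "\<theta>\<^sup>2 = t\<^sup>2" by fact
    finally have "f y = f u + 2 * t * (e * s)"
      unfolding f_def By by (simp add: s_def \<theta>_def algebra_simps)
    moreover have "2 * t * (e * s) \<le> 0" using t(1) e(1) by (simp add: mult_nonneg_nonpos)
    \<comment> \<open>Moving along \<open>v\<close> leaves each \<open>w j \<bullet> u\<close>
      unchanged, so \<open>y\<close> stays in all half-spaces.\<close>
    moreover have "w j \<bullet> y \<le> \<beta> j" if "j \<in> {1..l}" for j
      using z(3)[OF that] w[OF that] u v feas that g_iff unfolding y_def
      by (simp add: scalar_prod_add_distrib[of _ n] flip: v_def)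
    then have "E y \<le> D" using bound[OF y] ByR unfolding E_def B_def by auto
    then have "0 \<le> f y" unfolding f_def ByR by simp
    ultimately show ?thesis by linarith
  qed
  have "\<exists>\<mu>. (\<forall>j. 0 \<le> \<mu> j) \<and> (\<forall>u\<in>carrier_vec n. 0 \<le> f u + (\<Sum>j\<in>{0..l}. \<mu> j * g j u))"
    by (rule lagrange_multipliers[OF _ conv slater(1) _ nonneg])
       (use slater in \<open>auto simp: g_def B_def\<close>)
  then obtain \<mu> where \<mu>: "\<forall>j. 0 \<le> \<mu> j"
    "\<forall>u\<in>carrier_vec n. 0 \<le> f u + (\<Sum>j\<in>{0..l}. \<mu> j * g j u)" by blast
  \<comment> \<open>The \<open>\<sigma>\<close> copies of the ball constraint hidden in
    \<open>f\<close> are moved into its multiplier.\<close>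
  have "E u \<le> D + (\<mu> 0 + \<sigma>) * (B u - R) + (\<Sum>j=1..l. \<mu> j * (w j \<bullet> u - \<beta> j))"
    if "u \<in> carrier_vec n" for u
  proof -
    have "(\<Sum>j\<in>{0..l}. \<mu> j * g j u) = \<mu> 0 * (B u - R) + (\<Sum>j=1..l. \<mu> j * (w j \<bullet> u - \<beta> j))"
      by (simp add: sum.atLeast_Suc_atMost g_def)
    then show ?thesis using \<mu>(2)[rule_format, OF that] by (simp add: f_def algebra_simps)
  qed
  then show ?thesis using \<mu>(1) \<sigma> unfolding E_def B_def
    by (intro exI[of _ "\<mu>(0 := \<mu> 0 + \<sigma>)"]) (auto intro: add_nonneg_nonneg)
qed

section \<open>The linear matrix inequality\<close>

lemma quadratic_form_four_block:
  fixes A B D :: "real mat"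
  assumes A: "A \<in> carrier_mat k k" and B: "B \<in> carrier_mat k n" and D: "D \<in> carrier_mat n n"
    and p: "p \<in> carrier_vec k" and q: "q \<in> carrier_vec n"
  shows "(p @\<^sub>v q) \<bullet> (four_block_mat A B (B\<^sup>T) D *\<^sub>v (p @\<^sub>v q)) =
    p \<bullet> (A *\<^sub>v p) + 2 * (p \<bullet> (B *\<^sub>v q)) + q \<bullet> (D *\<^sub>v q)"
proof -
  have "q \<bullet> (B\<^sup>T *\<^sub>v p) = p \<bullet> (B *\<^sub>v q)"
    using comm_scalar_prod[of q n "B\<^sup>T *\<^sub>v p"] transpose_vec_mult_scalar[OF B q p] B p q by simp
  moreover have "(p @\<^sub>v q) \<bullet> (four_block_mat A B (B\<^sup>T) D *\<^sub>v (p @\<^sub>v q)) =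
      p \<bullet> (A *\<^sub>v p + B *\<^sub>v q) + q \<bullet> (B\<^sup>T *\<^sub>v p + D *\<^sub>v q)"
    using A B D p q
    by (subst four_block_mat_mult_vec[of _ k k _ n _ n]) (auto intro!: scalar_prod_append)
  ultimately show ?thesis using A B D p q
    by (simp add: scalar_prod_add_distrib[of _ k] scalar_prod_add_distrib[of _ n])
qed

text \<open>A test vector is split along the three blocks into \<open>p\<close>, \<open>q\<close>
  and a scalar \<open>t\<close>. The nested form is expanded by
  \<open>quadratic_form_four_block\<close>, first for the outer bordering and then for the inner
  block. Symmetry holds by construction.\<close>

lemma psd_lmi_mat_iff:
  fixes k n l :: nat and w :: "nat \<Rightarrow> real vec" and \<beta> :: "nat \<Rightarrow> real" and lam :: "real vec"
    and d \<rho> :: real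
  defines "N \<equiv> k * (n + 1)"
  assumes B0: "B0 \<in> carrier_mat k n" and b0: "b0 \<in> carrier_vec k" and \<Delta>c: "\<Delta>c \<in> carrier_mat k (n + 1)"
    and w: "\<And>j. j \<in> {1..l} \<Longrightarrow> w j \<in> carrier_vec N" and x: "x \<in> carrier_vec n"
  defines "X \<equiv> kron_id_row k (x @\<^sub>v vec_of_list [- 1])" and "r \<equiv> B0 *\<^sub>v x - b0"
    and "c \<equiv> vectorise \<Delta>c"
  defines "h \<equiv> vec N (\<lambda>r. - (lam $ 0) * c $ r + 1/2 * (\<Sum>j=1..l. lam $ j * w j $ r))"
    and "\<tau> \<equiv> d\<^sup>2 - lam $ 0 * (\<rho>\<^sup>2 - (vec_norm c)\<^sup>2) - (\<Sum>j=1..l. lam $ j * \<beta> j)"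
  shows "psd (lmi_mat n k l B0 b0 \<Delta>c \<rho> w \<beta> d x lam) \<longleftrightarrow>
    (\<forall>p\<in>carrier_vec k. \<forall>q\<in>carrier_vec N. \<forall>t. 0 \<le> p \<bullet> p + 2 * (p \<bullet> (X *\<^sub>v q)) + lam $ 0 * (q \<bullet> q)
       + 2 * t * (p \<bullet> r + q \<bullet> h) + t\<^sup>2 * \<tau>)"
proof -
  define A where "A = four_block_mat (1\<^sub>m k) X (X\<^sup>T) (lam $ 0 \<cdot>\<^sub>m 1\<^sub>m N)"
  define C where "C = mat_of_cols (k + N) [r @\<^sub>v h]"
  define T where "T = mat 1 1 (\<lambda>_. \<tau>)"
  have X: "X \<in> carrier_mat k N" unfolding X_def N_def
    using kron_id_row_carrier[of k "x @\<^sub>v vec_of_list [- 1]"] x by simp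
  have r: "r \<in> carrier_vec k" unfolding r_def using B0 b0 x by simp
  have h: "h \<in> carrier_vec N" unfolding h_def by simp
  have A: "A \<in> carrier_mat (k + N) (k + N)" unfolding A_def using X by simp
  have C: "C \<in> carrier_mat (k + N) 1" unfolding C_def using mat_of_cols_carrier(1)[of "k + N" "[r @\<^sub>v h]"] by simp
  have T: "T \<in> carrier_mat 1 1" unfolding T_def by simp
  have M: "lmi_mat n k l B0 b0 \<Delta>c \<rho> w \<beta> d x lam = four_block_mat A C (C\<^sup>T) T" (is "?M = _")
    unfolding lmi_mat_def Let_def A_def C_def T_def X_def r_def h_def c_def \<tau>_def N_def by simp
  have Mc: "?M \<in> carrier_mat (k + N + 1) (k + N + 1)" unfolding M using A T by (rule four_block_carrier_mat)
  have "A\<^sup>T = A" unfolding A_def using X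
    by (subst transpose_four_block_mat[of _ k k _ N _ N]) auto
  moreover have "T\<^sup>T = T" unfolding T_def by (intro eq_matI) auto
  ultimately have sym: "?M\<^sup>T = ?M" unfolding M using A C T
    by (subst transpose_four_block_mat[of _ "k + N" "k + N" _ 1 _ 1]) auto
  have form: "((p @\<^sub>v q) @\<^sub>v vec 1 (\<lambda>_. t)) \<bullet> (?M *\<^sub>v ((p @\<^sub>v q) @\<^sub>v vec 1 (\<lambda>_. t))) =
      p \<bullet> p + 2 * (p \<bullet> (X *\<^sub>v q)) + lam $ 0 * (q \<bullet> q) + 2 * t * (p \<bullet> r + q \<bullet> h) + t\<^sup>2 * \<tau>"
    if p: "p \<in> carrier_vec k" and q: "q \<in> carrier_vec N" for p q t
  proof -
    let ?s = "vec 1 (\<lambda>_. t) :: real vec"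
    have "C *\<^sub>v ?s = t \<cdot>\<^sub>v (r @\<^sub>v h)"
      using r h by (intro eq_vecI) (auto simp: C_def mat_of_cols_def scalar_prod_def)
    then have "(p @\<^sub>v q) \<bullet> (C *\<^sub>v ?s) = t * (p \<bullet> r + q \<bullet> h)"
      using p q r h scalar_prod_append[OF p q r h] by simp
    moreover have "?s \<bullet> (T *\<^sub>v ?s) = t\<^sup>2 * \<tau>"
      by (simp add: T_def scalar_prod_def power2_eq_square)
    moreover have "(lam $ 0 \<cdot>\<^sub>m 1\<^sub>m N) *\<^sub>v q = lam $ 0 \<cdot>\<^sub>v q"
      using q by (intro eq_vecI) auto
    then have "(p @\<^sub>v q) \<bullet> (A *\<^sub>v (p @\<^sub>v q)) = p \<bullet> p + 2 * (p \<bullet> (X *\<^sub>v q)) + lam $ 0 * (q \<bullet> q)"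
      unfolding A_def using quadratic_form_four_block[OF one_carrier_mat X _ p q, of "lam $ 0 \<cdot>\<^sub>m 1\<^sub>m N"] p q
      by simp
    ultimately show ?thesis
      unfolding M using quadratic_form_four_block[OF A C T, of "p @\<^sub>v q" ?s] p q by simp
  qed
  have all: "(\<forall>y\<in>carrier_vec (k + N + 1). P y) \<longleftrightarrow>
      (\<forall>p\<in>carrier_vec k. \<forall>q\<in>carrier_vec N. \<forall>t. P ((p @\<^sub>v q) @\<^sub>v vec 1 (\<lambda>_. t)))" for P :: "real vec \<Rightarrow> bool"
  proof (intro iffI ballI allI)
    fix y :: "real vec"
    assume P: "\<forall>p\<in>carrier_vec k. \<forall>q\<in>carrier_vec N. \<forall>t. P ((p @\<^sub>v q) @\<^sub>v vec 1 (\<lambda>_. t))"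
      and y: "y \<in> carrier_vec (k + N + 1)"
    have "y = (vec k (\<lambda>i. y $ i) @\<^sub>v vec N (\<lambda>i. y $ (k + i))) @\<^sub>v vec 1 (\<lambda>_. y $ (k + N))"
      using y by (intro eq_vecI) (auto simp: less_Suc_eq)
    then show "P y" using P by (metis vec_carrier)
  next
    fix p q :: "real vec" and t :: real
    assume P: "\<forall>y\<in>carrier_vec (k + N + 1). P y" and "p \<in> carrier_vec k" "q \<in> carrier_vec N"
    then have "(p @\<^sub>v q) @\<^sub>v vec 1 (\<lambda>_. t) \<in> carrier_vec (k + N + 1)"
      by (intro append_carrier_vec) auto
    with P show "P ((p @\<^sub>v q) @\<^sub>v vec 1 (\<lambda>_. t))" by (rule bspec)
  qed
  have dims: "square_mat ?M" "dim_row ?M = k + N + 1" using Mc by auto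
  have "psd ?M \<longleftrightarrow> (\<forall>y\<in>carrier_vec (k + N + 1). 0 \<le> y \<bullet> (?M *\<^sub>v y))"
    unfolding psd_def dims(2) using sym dims(1) by blast
  then show ?thesis unfolding all by (simp only: form cong: ball_cong)
qed

section \<open>Vectorisation\<close>

lemma vectorise_carrier: "M \<in> carrier_mat p q \<Longrightarrow> vectorise M \<in> carrier_vec (p * q)"
  by (intro carrier_vecI) (simp add: vectorise_def stack_cols_def mult.commute[of q])

lemma div_mod_less:
  fixes r p q :: nat
  assumes "r < p * q"
  shows "r div q < p" "r mod q < q"
proof -
  show "r div q < p" by (rule less_mult_imp_div_less[OF assms])
  have "q \<noteq> 0" using assms by (cases q) auto
  then show "r mod q < q" by simp
qed

lemma vectorise_index:
  assumes M: "M \<in> carrier_mat p q" and r: "r < p * q"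
  shows "vectorise M $ r = M $$ (r div q, r mod q)"
  using M r div_mod_less[OF r] by (simp add: vectorise_def stack_cols_def mult.commute[of q])

lemma vectorise_minus:
  assumes M: "M \<in> carrier_mat p q" and M': "M' \<in> carrier_mat p q"
  shows "vectorise (M - M') = vectorise M - vectorise M'"
proof (rule eq_vecI)
  show "dim_vec (vectorise (M - M')) = dim_vec (vectorise M - vectorise M')"
    using M M' by (simp add: vectorise_def stack_cols_def)
  fix r assume "r < dim_vec (vectorise M - vectorise M')"
  then have dim: "r < dim_vec (vectorise M')" and r: "r < p * q"
    using carrier_vecD[OF vectorise_carrier[OF M']] by auto
  have lt: "r div q < dim_row M'" "r mod q < dim_col M'"
    using div_mod_less[OF r] M' by auto
  show "vectorise (M - M') $ r = (vectorise M - vectorise M') $ r"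
    unfolding vectorise_index[OF minus_carrier_mat[OF M'] r] index_minus_vec(1)[OF dim]
      index_minus_mat(1)[OF lt] vectorise_index[OF M r] vectorise_index[OF M' r] ..
qed

lemma ex_vectorise_eq:
  assumes u: "u \<in> carrier_vec (p * q)"
  obtains M where "M \<in> carrier_mat p q" "vectorise M = u"
proof
  let ?M = "mat p q (\<lambda>(i, j). u $ (i * q + j))"
  show M: "?M \<in> carrier_mat p q" by simp
  show "vectorise ?M = u"
  proof (rule eq_vecI)
    show "dim_vec (vectorise ?M) = dim_vec u" using u vectorise_carrier[OF M] by simp
    fix r assume "r < dim_vec u"
    then have r: "r < p * q" using u by simp
    show "vectorise ?M $ r = u $ r" using vectorise_index[OF M r] div_mod_less[OF r] by simp
  qed
qed

text \<open>Both squares sum the squared entries. The vector runs through them row by row, in groups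
  of \<open>q\<close>, while the trace runs through the columns, hence the interchange of
  sums.\<close>

lemma frob_norm_eq_vec_norm_vectorise:
  assumes M: "M \<in> carrier_mat p q"
  shows "frob_norm M = vec_norm (vectorise M)"
proof -
  let ?v = "vectorise M"
  have idx: "?v $ (i * q + j) = M $$ (i, j)" if "i < p" "j < q" for i j
  proof -
    have "i * q + j < Suc i * q" using that by simp
    also have "\<dots> \<le> p * q" using that by (intro mult_le_mono1) simp
    finally show ?thesis using that vectorise_index[OF M, of "i * q + j"] by simp
  qed
  have "?v \<bullet> ?v = (\<Sum>r<p * q. ?v $ r * ?v $ r)"
    using vectorise_carrier[OF M] by (simp add: scalar_prod_def atLeast0LessThan)
  also have "\<dots> = (\<Sum>i<p. \<Sum>r\<in>{i * q..<i * q + q}. ?v $ r * ?v $ r)"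
    by (rule sum.nat_group[symmetric])
  also have "\<dots> = (\<Sum>i<p. \<Sum>j<q. ?v $ (i * q + j) * ?v $ (i * q + j))"
  proof (rule sum.cong[OF refl])
    fix i
    show "(\<Sum>r\<in>{i * q..<i * q + q}. ?v $ r * ?v $ r) = (\<Sum>j<q. ?v $ (i * q + j) * ?v $ (i * q + j))"
      by (rule sum.reindex_bij_witness[of _ "\<lambda>j. i * q + j" "\<lambda>r. r - i * q"]) auto
  qed
  also have "\<dots> = (\<Sum>i<p. \<Sum>j<q. M $$ (i, j) * M $$ (i, j))"
    by (simp add: idx)
  also have "\<dots> = (\<Sum>j<q. \<Sum>i<p. M $$ (i, j) * M $$ (i, j))" by (rule sum.swap)
  also have "\<dots> = mat_trace (M\<^sup>T * M)"
    using M by (simp add: mat_trace_def scalar_prod_def atLeast0LessThan)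
  finally show ?thesis by (simp add: frob_norm_def vec_norm_def)
qed

text \<open>The transpose sends \<open>z\<close> to the vectorised outer product of \<open>z\<close>
  and \<open>y\<close>. Applying \<open>kron_id_row p y\<close> to it then multiplies that rank-one
  matrix by \<open>y\<close>.\<close>

lemma kron_id_row_coisometry:
  assumes y: "y \<in> carrier_vec q" and z: "z \<in> carrier_vec p"
  shows "kron_id_row p y *\<^sub>v ((kron_id_row p y)\<^sup>T *\<^sub>v z) = (y \<bullet> y) \<cdot>\<^sub>v z"
proof -
  let ?M = "mat p q (\<lambda>(i, j). z $ i * y $ j)"
  have M: "?M \<in> carrier_mat p q" by simp
  have K: "kron_id_row p y \<in> carrier_mat p (p * q)" using kron_id_row_carrier[of p y] y by simp
  have "(kron_id_row p y)\<^sup>T *\<^sub>v z = vectorise ?M"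
  proof (rule eq_vecI)
    show "dim_vec ((kron_id_row p y)\<^sup>T *\<^sub>v z) = dim_vec (vectorise ?M)"
      using K vectorise_carrier[OF M] by simp
    fix r assume "r < dim_vec (vectorise ?M)"
    then have r: "r < p * q" using vectorise_carrier[OF M] by simp
    note lt = div_mod_less[OF r]
    have "((kron_id_row p y)\<^sup>T *\<^sub>v z) $ r = (\<Sum>i<p. kron_id_row p y $$ (i, r) * z $ i)"
      using K z r by (simp add: scalar_prod_def atLeast0LessThan)
    also have "\<dots> = (\<Sum>i<p. if i = r div q then y $ (r mod q) * z $ i else 0)"
      using y r by (intro sum.cong) (auto simp: kron_id_row_index)
    also have "\<dots> = z $ (r div q) * y $ (r mod q)" using lt by simp
    finally show "((kron_id_row p y)\<^sup>T *\<^sub>v z) $ r = vectorise ?M $ r"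
      using vectorise_index[OF M r] lt by simp
  qed
  then have "kron_id_row p y *\<^sub>v ((kron_id_row p y)\<^sup>T *\<^sub>v z) = ?M *\<^sub>v y"
    using kron_id_row_mult[OF M y] by simp
  also have "\<dots> = (y \<bullet> y) \<cdot>\<^sub>v z"
    using y z by (intro eq_vecI) (auto simp: scalar_prod_def sum_distrib_left sum_distrib_right ac_simps)
  finally show ?thesis .
qed

section \<open>Augmented matrices and their residuals\<close>

lemma aug_mat_carrier: "B \<in> carrier_mat k n \<Longrightarrow> aug_mat B b \<in> carrier_mat k (n + 1)"
  using mat_of_cols_carrier(1)[of k "cols B @ [b]"] by (simp add: aug_mat_def)

lemma aug_mat_index:
  "B \<in> carrier_mat k n \<Longrightarrow> b \<in> carrier_vec k \<Longrightarrow> i < k \<Longrightarrow> j < n + 1 \<Longrightarrow>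
    aug_mat B b $$ (i, j) = (if j < n then B $$ (i, j) else b $ i)"
  by (auto simp: aug_mat_def mat_of_cols_def nth_append less_Suc_eq)

lemma aug_mat_mult:
  assumes "B \<in> carrier_mat k n" "b \<in> carrier_vec k" "x \<in> carrier_vec n"
  shows "aug_mat B b *\<^sub>v (x @\<^sub>v vec_of_list [- 1]) = B *\<^sub>v x - b"
proof (rule eq_vecI)
  have dims: "dim_row (aug_mat B b) = k" "dim_col (aug_mat B b) = n + 1"
    using aug_mat_carrier[OF assms(1), of b] by auto
  show "dim_vec (aug_mat B b *\<^sub>v (x @\<^sub>v vec_of_list [- 1])) = dim_vec (B *\<^sub>v x - b)"
    using assms dims by simp
  fix i assume "i < dim_vec (B *\<^sub>v x - b)"
  then have i: "i < k" using assms by simp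
  have "(aug_mat B b *\<^sub>v (x @\<^sub>v vec_of_list [- 1])) $ i =
      (\<Sum>j<Suc n. aug_mat B b $$ (i, j) * (x @\<^sub>v vec_of_list [- 1]) $ j)"
    using i assms dims by (simp add: scalar_prod_def atLeast0LessThan)
  also have "\<dots> = (\<Sum>j<n. B $$ (i, j) * x $ j) - b $ i"
    using i assms by (simp add: aug_mat_index)
  also have "\<dots> = (B *\<^sub>v x - b) $ i"
    using i assms by (simp add: scalar_prod_def atLeast0LessThan)
  finally show "(aug_mat B b *\<^sub>v (x @\<^sub>v vec_of_list [- 1])) $ i = (B *\<^sub>v x - b) $ i" .
qed

lemma ex_aug_mat_eq:
  assumes M: "M \<in> carrier_mat k (n + 1)"
  obtains B b where "B \<in> carrier_mat k n" "b \<in> carrier_vec k" "aug_mat B b = M"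
proof
  let ?B = "mat k n (\<lambda>(i, j). M $$ (i, j))" and ?b = "vec k (\<lambda>i. M $$ (i, n))"
  show B: "?B \<in> carrier_mat k n" and b: "?b \<in> carrier_vec k" by auto
  show "aug_mat ?B ?b = M"
  proof (rule eq_matI)
    fix i j assume "i < dim_row M" "j < dim_col M"
    then have ij: "i < k" "j < n + 1" using M by auto
    then have "j < n \<or> j = n" by auto
    then show "aug_mat ?B ?b $$ (i, j) = M $$ (i, j)"
      using aug_mat_index[OF B b ij] ij by auto
  qed (use M aug_mat_carrier[OF B] in auto)
qed

section \<open>The robust counterpart of one constraint\<close>

text \<open>Multiplying an augmented matrix by \<open>(x, -1)\<close> gives the residual, so the
  residual is affine in the perturbation. Every perturbed matrix splits back into a pair
  \<open>B\<close>, \<open>b\<close>, so the quantifier can range over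
  \<open>\<Delta>\<close>.\<close>

lemma robust_constraint_iff:
  assumes B0: "B0 \<in> carrier_mat k n" and b0: "b0 \<in> carrier_vec k" and x: "x \<in> carrier_vec n"
  shows "(\<forall>B\<in>carrier_mat k n. \<forall>b\<in>carrier_vec k.
        aug_mat B b \<in> uncertainty_set n k l B0 b0 \<Delta>c \<rho> w \<beta> \<longrightarrow> vec_norm (B *\<^sub>v x - b) \<le> d) \<longleftrightarrow>
    (\<forall>\<Delta>\<in>carrier_mat k (n + 1). frob_norm (\<Delta> - \<Delta>c) \<le> \<rho> \<longrightarrow> (\<forall>j\<in>{1..l}. w j \<bullet> vectorise \<Delta> \<le> \<beta> j) \<longrightarrow>
        vec_norm ((B0 *\<^sub>v x - b0) + \<Delta> *\<^sub>v (x @\<^sub>v vec_of_list [- 1])) \<le> d)"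
    (is "?L \<longleftrightarrow> ?R")
proof -
  let ?y = "x @\<^sub>v vec_of_list [- 1]"
  have y: "?y \<in> carrier_vec (n + 1)" using x by (intro append_carrier_vec) auto
  have eq: "B *\<^sub>v x - b = (B0 *\<^sub>v x - b0) + \<Delta> *\<^sub>v ?y"
    if "B \<in> carrier_mat k n" "b \<in> carrier_vec k" "\<Delta> \<in> carrier_mat k (n + 1)"
      "aug_mat B b = aug_mat B0 b0 + \<Delta>" for B b \<Delta>
    using aug_mat_mult[OF that(1,2) x] aug_mat_mult[OF B0 b0 x] that(4)
      add_mult_distrib_mat_vec[OF aug_mat_carrier[OF B0, of b0] that(3) y] by simp
  show ?thesis
  proof
    assume L: ?L
    show ?R
    proof (intro ballI impI)
      fix \<Delta> assume \<Delta>: "\<Delta> \<in> carrier_mat k (n + 1)" "frob_norm (\<Delta> - \<Delta>c) \<le> \<rho>"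
        "\<forall>j\<in>{1..l}. w j \<bullet> vectorise \<Delta> \<le> \<beta> j"
      obtain B b where B: "B \<in> carrier_mat k n" "b \<in> carrier_vec k" "aug_mat B b = aug_mat B0 b0 + \<Delta>"
        using ex_aug_mat_eq[of "aug_mat B0 b0 + \<Delta>" k n] \<Delta>(1) aug_mat_carrier[OF B0] by auto
      then have "vec_norm (B *\<^sub>v x - b) \<le> d"
        using L \<Delta> unfolding uncertainty_set_def by blast
      then show "vec_norm ((B0 *\<^sub>v x - b0) + \<Delta> *\<^sub>v ?y) \<le> d" using eq[OF B(1,2) \<Delta>(1) B(3)] by simp
    qed
  next
    assume ?R
    then show ?L unfolding uncertainty_set_def using eq by fastforce
  qed
qed

text \<open>Eliminating \<open>p\<close> from the quadratic form, as in a Schur complement of the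
  identity block, leaves the homogenised inequality between the squared residual and the Lagrangian.
  From left to right the multipliers come from the S-lemma; conversely a single test vector for each
  perturbation suffices.\<close>

lemma robust_constraint_iff_lmi:
  fixes k n l :: nat and w :: "nat \<Rightarrow> real vec" and \<beta> :: "nat \<Rightarrow> real" and d \<rho> :: real
  assumes B0: "B0 \<in> carrier_mat k n" and b0: "b0 \<in> carrier_vec k" and \<Delta>c: "\<Delta>c \<in> carrier_mat k (n + 1)"
    and w: "\<And>j. j \<in> {1..l} \<Longrightarrow> w j \<in> carrier_vec (k * (n + 1))" and d: "0 \<le> d"
    and dim: "vec_space.span_dim (k * (n + 1)) (w ` {1..l}) < k"
    and slater: "\<Delta>0 \<in> carrier_mat k (n + 1)" "frob_norm (\<Delta>0 - \<Delta>c) < \<rho>"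
      "\<And>j. j \<in> {1..l} \<Longrightarrow> w j \<bullet> vectorise \<Delta>0 < \<beta> j"
    and x: "x \<in> carrier_vec n"
  shows "(\<forall>\<Delta>\<in>carrier_mat k (n + 1). frob_norm (\<Delta> - \<Delta>c) \<le> \<rho> \<longrightarrow> (\<forall>j\<in>{1..l}. w j \<bullet> vectorise \<Delta> \<le> \<beta> j) \<longrightarrow>
        vec_norm ((B0 *\<^sub>v x - b0) + \<Delta> *\<^sub>v (x @\<^sub>v vec_of_list [- 1])) \<le> d) \<longleftrightarrow>
    (\<exists>lam\<in>carrier_vec (l + 1). (\<forall>j\<le>l. 0 \<le> lam $ j) \<and> psd (lmi_mat n k l B0 b0 \<Delta>c \<rho> w \<beta> d x lam))"
    (is "?L \<longleftrightarrow> ?R")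
proof -
  define N where "N = k * (n + 1)"
  define y where "y = x @\<^sub>v vec_of_list [- 1 :: real]"
  define X where "X = kron_id_row k y"
  define r where "r = B0 *\<^sub>v x - b0"
  define c where "c = vectorise \<Delta>c"
  define \<sigma> where "\<sigma> = y \<bullet> y"
  define h where "h lam = vec N (\<lambda>r. - (lam $ 0) * c $ r + 1/2 * (\<Sum>j=1..l. lam $ j * w j $ r))" for lam
  define \<tau> where "\<tau> lam = d\<^sup>2 - lam $ 0 * (\<rho>\<^sup>2 - (vec_norm c)\<^sup>2) - (\<Sum>j=1..l. lam $ j * \<beta> j)" for lam
  have y: "y \<in> carrier_vec (n + 1)" unfolding y_def using x by (intro append_carrier_vec) auto
  \<comment> \<open>The appended entry -1 keeps \<open>y\<close> nonzero even at
    \<open>x = 0\<close>, so \<open>\<sigma>\<close> is positive.\<close>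
  have "y $ n \<noteq> 0" unfolding y_def using x by simp
  then have \<sigma>: "0 < \<sigma>" unfolding \<sigma>_def using y by (intro scalar_prod_self_pos[of _ "n + 1"]) auto
  have X: "X \<in> carrier_mat k N" using kron_id_row_carrier[of k y] y by (simp add: X_def N_def)
  have r: "r \<in> carrier_vec k" unfolding r_def using B0 b0 x by simp
  have c: "c \<in> carrier_vec N" unfolding c_def N_def by (rule vectorise_carrier[OF \<Delta>c])
  have wN: "w j \<in> carrier_vec N" if "j \<in> {1..l}" for j using w that by (simp add: N_def)
  have h: "h lam \<in> carrier_vec N" for lam by (simp add: h_def)
  have coiso: "X *\<^sub>v (X\<^sup>T *\<^sub>v z) = \<sigma> \<cdot>\<^sub>v z" if "z \<in> carrier_vec k" for z
    unfolding X_def \<sigma>_def by (rule kron_id_row_coisometry[OF y that])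
  have psd_iff: "psd (lmi_mat n k l B0 b0 \<Delta>c \<rho> w \<beta> d x lam) \<longleftrightarrow>
      (\<forall>p\<in>carrier_vec k. \<forall>q\<in>carrier_vec N. \<forall>t. 0 \<le> p \<bullet> p + 2 * (p \<bullet> (X *\<^sub>v q)) + lam $ 0 * (q \<bullet> q)
       + 2 * t * (p \<bullet> r + q \<bullet> h lam) + t\<^sup>2 * \<tau> lam)" for lam
    unfolding X_def y_def r_def c_def h_def \<tau>_def N_def by (rule psd_lmi_mat_iff[OF B0 b0 \<Delta>c w x])
  have frob: "(frob_norm (\<Delta> - \<Delta>c))\<^sup>2 = (vectorise \<Delta> - c) \<bullet> (vectorise \<Delta> - c)" "0 \<le> frob_norm (\<Delta> - \<Delta>c)"
    if "\<Delta> \<in> carrier_mat k (n + 1)" for \<Delta>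
    using frob_norm_eq_vec_norm_vectorise[OF minus_carrier_mat[OF \<Delta>c]] vectorise_minus[OF that \<Delta>c]
      scalar_prod_self_nonneg by (auto simp: vec_norm_def c_def)
  have \<rho>: "0 \<le> \<rho>" using frob(2)[OF slater(1)] slater(2) by simp
  \<comment> \<open>The lower right part of the matrix, evaluated at \<open>(u, 1)\<close>, is the
    Lagrangian; the norm of \<open>c\<close> in \<open>\<tau>\<close> completes the square of the
    ball term.\<close>
  have lagrangian: "lam $ 0 * (u \<bullet> u) + 2 * (u \<bullet> h lam) + \<tau> lam =
      d\<^sup>2 + lam $ 0 * ((u - c) \<bullet> (u - c) - \<rho>\<^sup>2) + (\<Sum>j=1..l. lam $ j * (w j \<bullet> u - \<beta> j))"
    if u: "u \<in> carrier_vec N" for u lam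
  proof -
    have "u \<bullet> h lam = (\<Sum>i<N. - (lam $ 0) * (u $ i * c $ i)) +
        1/2 * (\<Sum>i<N. \<Sum>j=1..l. lam $ j * (w j $ i * u $ i))"
      unfolding sum_distrib_left sum.distrib[symmetric]
      by (simp add: h_def scalar_prod_def atLeast0LessThan sum_distrib_left algebra_simps)
    also have "(\<Sum>i<N. - (lam $ 0) * (u $ i * c $ i)) = - (lam $ 0) * (u \<bullet> c)"
      using c unfolding sum_distrib_left[symmetric] by (simp add: scalar_prod_def atLeast0LessThan)
    also have "(\<Sum>i<N. \<Sum>j=1..l. lam $ j * (w j $ i * u $ i)) =
        (\<Sum>j=1..l. \<Sum>i<N. lam $ j * (w j $ i * u $ i))" by (rule sum.swap)
    also have "\<dots> = (\<Sum>j=1..l. lam $ j * (w j \<bullet> u))"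
      using u unfolding sum_distrib_left[symmetric] by (simp add: scalar_prod_def atLeast0LessThan)
    finally have "2 * (u \<bullet> h lam) = - 2 * lam $ 0 * (u \<bullet> c) + (\<Sum>j=1..l. lam $ j * (w j \<bullet> u))" by simp
    moreover have "(vec_norm c)\<^sup>2 = c \<bullet> c" using scalar_prod_self_nonneg by (simp add: vec_norm_def)
    ultimately show ?thesis unfolding \<tau>_def scalar_prod_self_diff[OF u c]
      by (simp add: algebra_simps sum_subtractf)
  qed
  have Xvec: "X *\<^sub>v vectorise \<Delta> = \<Delta> *\<^sub>v y" if "\<Delta> \<in> carrier_mat k (n + 1)" for \<Delta>
    unfolding X_def by (rule kron_id_row_mult[OF that y])
  show ?thesis
  proof
    assume L: ?L
    have img: "w ` {1..l} \<subseteq> carrier_vec N" using wN by blast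
    obtain z where z: "z \<in> carrier_vec k" "z \<noteq> 0\<^sub>v k"
        "\<And>v. v \<in> w ` {1..l} \<Longrightarrow> v \<bullet> (X\<^sup>T *\<^sub>v z) = 0"
      using vec_space.exists_transpose_mult_orthogonal[OF img _ X dim[folded N_def]] by blast
    have "\<exists>\<mu>. (\<forall>j. 0 \<le> \<mu> j) \<and> \<sigma> \<le> \<mu> 0 \<and> (\<forall>u\<in>carrier_vec N. (r + X *\<^sub>v u) \<bullet> (r + X *\<^sub>v u) \<le>
        d\<^sup>2 + \<mu> 0 * ((u - c) \<bullet> (u - c) - \<rho>\<^sup>2) + (\<Sum>j=1..l. \<mu> j * (w j \<bullet> u - \<beta> j)))"
    proof (rule ball_halfspaces_S_lemma[OF X \<sigma> coiso r c wN z(1,2)])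
      show "vectorise \<Delta>0 \<in> carrier_vec N" unfolding N_def by (rule vectorise_carrier[OF slater(1)])
      show "(vectorise \<Delta>0 - c) \<bullet> (vectorise \<Delta>0 - c) < \<rho>\<^sup>2"
        using frob[OF slater(1)] slater(2) by (simp add: power_strict_mono flip: frob(1)[OF slater(1)])
      fix u assume u: "u \<in> carrier_vec N" "(u - c) \<bullet> (u - c) \<le> \<rho>\<^sup>2" "\<forall>j\<in>{1..l}. w j \<bullet> u \<le> \<beta> j"
      obtain \<Delta> where \<Delta>: "\<Delta> \<in> carrier_mat k (n + 1)" "vectorise \<Delta> = u"
        using ex_vectorise_eq u(1) unfolding N_def by blast
      have "(frob_norm (\<Delta> - \<Delta>c))\<^sup>2 \<le> \<rho>\<^sup>2" using u(2) frob(1)[OF \<Delta>(1)] \<Delta>(2) by simp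
      then have "frob_norm (\<Delta> - \<Delta>c) \<le> \<rho>" using \<rho> by (rule power2_le_imp_le)
      then have "vec_norm (r + X *\<^sub>v u) \<le> d"
        using L \<Delta> u(3) Xvec[OF \<Delta>(1)] unfolding r_def y_def by auto
      then show "(r + X *\<^sub>v u) \<bullet> (r + X *\<^sub>v u) \<le> d\<^sup>2"
        unfolding vec_norm_def by (simp add: sqrt_le_D)
    qed (use slater z in auto)
    then obtain \<mu> where \<mu>: "\<forall>j. 0 \<le> \<mu> j" "\<sigma> \<le> \<mu> 0"
      "\<And>u. u \<in> carrier_vec N \<Longrightarrow> (r + X *\<^sub>v u) \<bullet> (r + X *\<^sub>v u) \<le>
        d\<^sup>2 + \<mu> 0 * ((u - c) \<bullet> (u - c) - \<rho>\<^sup>2) + (\<Sum>j=1..l. \<mu> j * (w j \<bullet> u - \<beta> j))" by blast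
    define lam where "lam = vec (l + 1) \<mu>"
    have lam: "lam $ j = \<mu> j" if "j \<le> l" for j using that by (simp add: lam_def)
    have bound: "(r + X *\<^sub>v u) \<bullet> (r + X *\<^sub>v u) \<le> lam $ 0 * (u \<bullet> u) + 2 * (u \<bullet> h lam) + \<tau> lam"
      if "u \<in> carrier_vec N" for u
      unfolding lagrangian[OF that] using \<mu>(3)[OF that] by (simp add: lam)
    have "0 \<le> p \<bullet> p + 2 * (p \<bullet> (X *\<^sub>v q)) + lam $ 0 * (q \<bullet> q) + 2 * t * (p \<bullet> r + q \<bullet> h lam) + t\<^sup>2 * \<tau> lam"
      if p: "p \<in> carrier_vec k" and q: "q \<in> carrier_vec N" for p q t
    proof -
      have Xq: "X *\<^sub>v q \<in> carrier_vec k" using X q by simp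
      \<comment> \<open>The homogenised residual: for \<open>t \<noteq> 0\<close> it is
        \<open>t\<close> times the residual at \<open>u = q / t\<close>, where \<open>bound\<close>
        applies.\<close>
      define e where "e = X *\<^sub>v q + t \<cdot>\<^sub>v r"
      have e: "e \<in> carrier_vec k" unfolding e_def using Xq r by simp
      have "e \<bullet> e \<le> lam $ 0 * (q \<bullet> q) + 2 * t * (q \<bullet> h lam) + t\<^sup>2 * \<tau> lam"
      proof (cases "t = 0")
        case True
        then have "e = X *\<^sub>v q" unfolding e_def using X r by (intro eq_vecI) auto
        \<comment> \<open>For \<open>t = 0\<close> there is no such point \<open>u\<close>; the
          contraction property and \<open>\<sigma> \<le> lam $ 0\<close> take the place of
          \<open>bound\<close>.\<close>
        then have "e \<bullet> e \<le> \<sigma> * (q \<bullet> q)"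
          using scaled_coisometry_contracts[OF X \<sigma> coiso q] by simp
        also have "\<dots> \<le> lam $ 0 * (q \<bullet> q)"
          using \<mu>(2) lam scalar_prod_self_nonneg by (intro mult_right_mono) auto
        finally show ?thesis using True by simp
      next
        case False
        define u where "u = (1 / t) \<cdot>\<^sub>v q"
        have u: "u \<in> carrier_vec N" unfolding u_def using q by simp
        have qu: "q = t \<cdot>\<^sub>v u" unfolding u_def using False q by (intro eq_vecI) auto
        have "e = t \<cdot>\<^sub>v (r + X *\<^sub>v u)"
          unfolding e_def qu using X r u by (intro eq_vecI) (auto simp: mult_mat_vec[of _ k N] algebra_simps)
        then have "e \<bullet> e = t\<^sup>2 * ((r + X *\<^sub>v u) \<bullet> (r + X *\<^sub>v u))"
          using X r u by (simp add: power2_eq_square)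
        also have "\<dots> \<le> t\<^sup>2 * (lam $ 0 * (u \<bullet> u) + 2 * (u \<bullet> h lam) + \<tau> lam)"
          using bound[OF u] by (intro mult_left_mono) auto
        also have "\<dots> = lam $ 0 * (q \<bullet> q) + 2 * t * (q \<bullet> h lam) + t\<^sup>2 * \<tau> lam"
          unfolding qu using u h by (simp add: power2_eq_square algebra_simps)
        finally show ?thesis .
      qed
      \<comment> \<open>Completing the square in \<open>p\<close> reduces the whole form to the
        bound on \<open>e \<bullet> e\<close>.\<close>
      moreover have "0 \<le> p \<bullet> p + 2 * (p \<bullet> e) + e \<bullet> e"
        using scalar_prod_self_nonneg[of "p + e"] scalar_prod_self_add[OF p e] by simp
      moreover have "p \<bullet> e = p \<bullet> (X *\<^sub>v q) + t * (p \<bullet> r)"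
        unfolding e_def using p Xq r by (simp add: scalar_prod_add_distrib[of _ k])
      ultimately show ?thesis by (simp add: algebra_simps)
    qed
    then have "psd (lmi_mat n k l B0 b0 \<Delta>c \<rho> w \<beta> d x lam)" unfolding psd_iff by blast
    moreover have "lam \<in> carrier_vec (l + 1)" unfolding lam_def by simp
    ultimately show ?R using \<mu>(1) lam by (intro bexI[of _ lam]) auto
  next
    assume ?R
    then obtain lam where lam: "\<forall>j\<le>l. 0 \<le> lam $ j"
      and psd: "psd (lmi_mat n k l B0 b0 \<Delta>c \<rho> w \<beta> d x lam)" by blast
    show ?L
    proof (intro ballI impI)
      fix \<Delta> assume \<Delta>: "\<Delta> \<in> carrier_mat k (n + 1)" "frob_norm (\<Delta> - \<Delta>c) \<le> \<rho>"
        "\<forall>j\<in>{1..l}. w j \<bullet> vectorise \<Delta> \<le> \<beta> j"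
      define u where "u = vectorise \<Delta>"
      define e where "e = r + X *\<^sub>v u"
      have u: "u \<in> carrier_vec N" unfolding u_def N_def by (rule vectorise_carrier[OF \<Delta>(1)])
      have e: "e \<in> carrier_vec k" unfolding e_def using X r u by simp
      \<comment> \<open>For \<open>q = u\<close> and \<open>t = 1\<close> the form is smallest at
        \<open>p = - e\<close>, where the terms in \<open>p\<close> contribute
        \<open>- (e \<bullet> e)\<close>.\<close>
      have "0 \<le> (- e) \<bullet> (- e) + 2 * ((- e) \<bullet> (X *\<^sub>v u)) + lam $ 0 * (u \<bullet> u)
          + 2 * ((- e) \<bullet> r + u \<bullet> h lam) + \<tau> lam"
        using psd[unfolded psd_iff, rule_format, of "- e" u 1] e u by simp
      moreover have "e \<bullet> e = e \<bullet> r + e \<bullet> (X *\<^sub>v u)"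
        using scalar_prod_add_distrib[OF e r, of "X *\<^sub>v u"] X u by (simp flip: e_def)
      ultimately have "e \<bullet> e \<le> lam $ 0 * (u \<bullet> u) + 2 * (u \<bullet> h lam) + \<tau> lam"
        using e X r u by simp
      also have "\<dots> = d\<^sup>2 + lam $ 0 * ((u - c) \<bullet> (u - c) - \<rho>\<^sup>2) + (\<Sum>j=1..l. lam $ j * (w j \<bullet> u - \<beta> j))"
        by (rule lagrangian[OF u])
      also have "\<dots> \<le> d\<^sup>2"
      proof -
        have "(u - c) \<bullet> (u - c) \<le> \<rho>\<^sup>2"
          using frob[OF \<Delta>(1)] \<Delta>(2) unfolding u_def by (metis power_mono)
        then have "lam $ 0 * ((u - c) \<bullet> (u - c) - \<rho>\<^sup>2) \<le> 0"
          using lam by (intro mult_nonneg_nonpos) auto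
        moreover have "(\<Sum>j=1..l. lam $ j * (w j \<bullet> u - \<beta> j)) \<le> 0"
          using lam \<Delta>(3) unfolding u_def by (intro sum_nonpos mult_nonneg_nonpos) auto
        ultimately show ?thesis by simp
      qed
      \<comment> \<open>The matrix knows only \<open>d\<^sup>2\<close>, so the sign of
        \<open>d\<close> is essential for taking the root.\<close>
      finally have "vec_norm e \<le> d" unfolding vec_norm_def using d by (rule real_le_lsqrt[rotated])
      then show "vec_norm ((B0 *\<^sub>v x - b0) + \<Delta> *\<^sub>v (x @\<^sub>v vec_of_list [- 1])) \<le> d"
        unfolding e_def u_def Xvec[OF \<Delta>(1)] r_def y_def .
    qed
  qed
qed

text \<open>The robust feasible set is the projection of the semidefinite one, and the objective
  does not depend on the multipliers, so minimisers correspond. With \<open>d i < 0\<close> the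
  robust problem would be infeasible, as the uncertainty sets are nonempty, while the matrix
  inequality would not see the sign; hence the condition on \<open>d\<close>.\<close>

theorem theorem5p2:
  fixes n m :: nat and k l :: "nat \<Rightarrow> nat"
    and a x :: "real vec" and d \<rho> :: "nat \<Rightarrow> real"
    and B0 \<Delta>c :: "nat \<Rightarrow> real mat" and b0 :: "nat \<Rightarrow> real vec"
    and w :: "nat \<Rightarrow> nat \<Rightarrow> real vec" and \<beta> :: "nat \<Rightarrow> nat \<Rightarrow> real"
  assumes "a \<in> carrier_vec n"
    and "\<And>i. i \<in> {1..m} \<Longrightarrow> B0 i \<in> carrier_mat (k i) n"
    and "\<And>i. i \<in> {1..m} \<Longrightarrow> b0 i \<in> carrier_vec (k i)"
    and "\<And>i. i \<in> {1..m} \<Longrightarrow> \<Delta>c i \<in> carrier_mat (k i) (n + 1)"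
    and "\<And>i j. i \<in> {1..m} \<Longrightarrow> j \<in> {1..l i} \<Longrightarrow> w i j \<in> carrier_vec (k i * (n + 1))"
    and "\<And>i. i \<in> {1..m} \<Longrightarrow> 0 \<le> d i"
    and "\<And>i. i \<in> {1..m} \<Longrightarrow> k i \<ge> vec_space.span_dim (k i * (n + 1)) (w i ` {1..l i}) + 1"
    and "\<And>i. i \<in> {1..m} \<Longrightarrow>
      {\<Delta> \<in> carrier_mat (k i) (n + 1). frob_norm (\<Delta> - \<Delta>c i) < \<rho> i \<and>
         (\<forall>j\<in>{1..l i}. w i j \<bullet> vectorise \<Delta> < \<beta> i j)} \<noteq> {}"
    and "x \<in> carrier_vec n"
  shows "is_arg_min (\<lambda>y. a \<bullet> y) (rsocp_feasible n m k l B0 b0 \<Delta>c \<rho> w \<beta> d) x \<longleftrightarrow>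
    (\<exists>lam :: nat \<Rightarrow> real vec.
      is_arg_min (\<lambda>(y, \<mu>). a \<bullet> y) (sdp_feasible n m k l B0 b0 \<Delta>c \<rho> w \<beta> d) (x, lam))"
proof -
  have feasible_iff: "rsocp_feasible n m k l B0 b0 \<Delta>c \<rho> w \<beta> d y \<longleftrightarrow>
      (\<exists>lam. sdp_feasible n m k l B0 b0 \<Delta>c \<rho> w \<beta> d (y, lam))" for y
  proof (cases "y \<in> carrier_vec n")
    case True
    have "(\<forall>B\<in>carrier_mat (k i) n. \<forall>b\<in>carrier_vec (k i).
          aug_mat B b \<in> uncertainty_set n (k i) (l i) (B0 i) (b0 i) (\<Delta>c i) (\<rho> i) (w i) (\<beta> i) \<longrightarrow>
          vec_norm (B *\<^sub>v y - b) \<le> d i) \<longleftrightarrow>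
        (\<exists>lam\<in>carrier_vec (l i + 1). (\<forall>j\<le>l i. 0 \<le> lam $ j) \<and>
          psd (lmi_mat n (k i) (l i) (B0 i) (b0 i) (\<Delta>c i) (\<rho> i) (w i) (\<beta> i) (d i) y lam))"
      if i: "i \<in> {1..m}" for i
    proof -
      obtain \<Delta>0 where \<Delta>0: "\<Delta>0 \<in> carrier_mat (k i) (n + 1)" "frob_norm (\<Delta>0 - \<Delta>c i) < \<rho> i"
          "\<And>j. j \<in> {1..l i} \<Longrightarrow> w i j \<bullet> vectorise \<Delta>0 < \<beta> i j"
        using assms(8)[OF i] by blast
      have dim: "vec_space.span_dim (k i * (n + 1)) (w i ` {1..l i}) < k i"
        using assms(7)[OF i] by simp
      show ?thesis
        unfolding robust_constraint_iff[OF assms(2,3)[OF i] True]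
        by (rule robust_constraint_iff_lmi[OF assms(2-4)[OF i] assms(5)[OF i] assms(6)[OF i] dim \<Delta>0 True])
    qed
    then have "rsocp_feasible n m k l B0 b0 \<Delta>c \<rho> w \<beta> d y \<longleftrightarrow>
        (\<forall>i\<in>{1..m}. \<exists>lam. lam \<in> carrier_vec (l i + 1) \<and> (\<forall>j\<le>l i. 0 \<le> lam $ j) \<and>
          psd (lmi_mat n (k i) (l i) (B0 i) (b0 i) (\<Delta>c i) (\<rho> i) (w i) (\<beta> i) (d i) y lam))"
      using True unfolding rsocp_feasible_def Bex_def by simp
    \<comment> \<open>The constraints have separate multipliers, so the vectors found for each
      \<open>i\<close> are collected into one function by choice.\<close>
    then show ?thesis unfolding bchoice_iff sdp_feasible_def using True by simp
  qed (simp add: rsocp_feasible_def sdp_feasible_def)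
  then show ?thesis unfolding is_arg_min_def by auto
qed

end
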